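(* Let $0<q<1$ and let $a,b,c,d$ satisfy $|a|,|b|,|c|,|d|<1$. Let $T_{a,c,d}$ be the linear transformation on polynomials in $x$ with $$T_{a,c,d}(x^k)=\frac{(ae^{i\theta},ae^{-i\theta};q)_k}{(ac;q)_k(ad;q)_k},\qquad k=0,1,2,\dots,\quad x=\cos\theta.$$ Then for every integer $n\ge0$ the Askey--Wilson polynomials $p_n(x;a,b,c,d|q)$ and the little $q$-Jacobi polynomials $q_n(x;\cdot,\cdot|q)$ are connected by $$p_n(x;a,b,c,d|q)=T_{a,c,d}\,q_n(x;ab/q,cd/q|q).$$
   Context: Notation: $(z;q)_k=\prod_{j=0}^{k-1}(1-zq^j)$, $(z_1,\dots,z_m;q)_k=\prod_i(z_i;q)_k$. For $x=\cos\theta$, $(ae^{i\theta},ae^{-i\theta};q)_k=\prod_{j=0}^{k-1}(1+a^2q^{2j}-2aq^jx)$ is a polynomial in $x$. Askey--Wilson polynomials: $$p_n(x;a,b,c,d|q)={}_4\phi_3\left(\left.\begin{array}{c}q^{-n},abcdq^{n-1},ae^{i\theta},ae^{-i\theta}\\ ab,ac,ad\end{array}\right|q,q\right)=\sum_{k=0}^n\frac{(q^{-n},abcdq^{n-1},ae^{i\theta},ae^{-i\theta};q)_k}{(ab,ac,ad,q;q)_k}q^k,\quad x=\cos\theta$$ (they are orthogonal on $[-1,1]$ with respect to the Askey--Wilson weight $\frac{(e^{2i\theta},e^{-2i\theta};q)_\infty}{(ae^{i\theta},ae^{-i\theta},be^{i\theta},be^{-i\theta},ce^{i\theta},ce^{-i\theta},de^{i\theta},de^{-i\theta};q)_\infty}\frac{dx}{\sqrt{1-x^2}}$).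 Little $q$-Jacobi polynomials: $$q_n(x;a,b|q)={}_2\phi_1\left(\left.\begin{array}{c}q^{-n},abq^{n+1}\\ aq\end{array}\right|q,qx\right)=\sum_{k=0}^n\frac{(q^{-n};q)_k(abq^{n+1};q)_k}{(aq;q)_k(q;q)_k}(qx)^k .$$ *)

theory Defs
  imports Complex_Main "HOL-Computational_Algebra.Polynomial"
begin

definition qpoch :: "complex \<Rightarrow> complex \<Rightarrow> nat \<Rightarrow> complex" where
  "qpoch z q k = (\<Prod>j<k. 1 - z * q ^ j)"

(* (z_1,...,z_m;q)_k *)
definition qpochs :: "complex list \<Rightarrow> complex \<Rightarrow> nat \<Rightarrow> complex" where
  "qpochs zs q k = (\<Prod>z\<leftarrow>zs. qpoch z q k)"

(* The series {r+1}phi_r; the extra denominator factor (q;q)_k is the list entry q. *)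
definition basic_hypergeom ::
    "complex list \<Rightarrow> complex list \<Rightarrow> complex \<Rightarrow> complex \<Rightarrow> complex" where
  "basic_hypergeom as bs q z = (\<Sum>k. qpochs as q k / qpochs (bs @ [q]) q k * z ^ k)"

(* The polynomial in x = cos theta given by (a e^{i theta}, a e^{-i theta}; q)_k;
   see poly_aw_basis_cos below. *)
definition aw_basis :: "complex \<Rightarrow> complex \<Rightarrow> nat \<Rightarrow> complex poly" where
  "aw_basis a q k = (\<Prod>j<k. [:1 + a\<^sup>2 * q ^ (2 * j), - 2 * a * q ^ j:])"

(* As polynomials in x; the integer powers cover q^{-n} and, for n = 0, q^{n-1}.
   The identification with 4phi3 is poly_askey_wilson_cos below. *)
definition askey_wilson ::
    "nat \<Rightarrow> complex \<Rightarrow> complex \<Rightarrow> complex \<Rightarrow> complex \<Rightarrow> complex \<Rightarrow> complex poly" where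
  "askey_wilson n a b c d q =
     (\<Sum>k\<le>n. smult (qpochs [q powi (- int n), a * b * c * d * q powi (int n - 1)] q k
                   / qpochs [a * b, a * c, a * d, q] q k * q ^ k) (aw_basis a q k))"

definition little_q_jacobi :: "nat \<Rightarrow> complex \<Rightarrow> complex \<Rightarrow> complex \<Rightarrow> complex poly" where
  "little_q_jacobi n a b q =
     (\<Sum>k\<le>n. smult (qpoch (q powi (- int n)) q k * qpoch (a * b * q ^ (n + 1)) q k
                   / (qpoch (a * q) q k * qpoch q q k)) ([:0, q:] ^ k))"

lemma poly_aw_basis_cos:
  "poly (aw_basis a q k) (of_real (cos \<theta>)) = qpochs [a * cis \<theta>, a * cis (- \<theta>)] q k"
proof -
  have c: "cis \<theta> + cis (- \<theta>) = 2 * of_real (cos \<theta>)"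
    by (simp add: complex_eq_iff)
  have m: "cis \<theta> * cis (- \<theta>) = 1"
    by (simp add: cis_mult)
  have "1 + a\<^sup>2 * q ^ (2 * j) + of_real (cos \<theta>) * (- 2 * a * q ^ j)
      = (1 - a * cis \<theta> * q ^ j) * (1 - a * cis (- \<theta>) * q ^ j)" for j
  proof -
    have "(1 - a * cis \<theta> * q ^ j) * (1 - a * cis (- \<theta>) * q ^ j)
        = 1 - a * q ^ j * (cis \<theta> + cis (- \<theta>)) + a\<^sup>2 * (q ^ j)\<^sup>2 * (cis \<theta> * cis (- \<theta>))"
      by (simp add: algebra_simps power2_eq_square)
    also have "\<dots> = 1 - a * q ^ j * (2 * of_real (cos \<theta>)) + a\<^sup>2 * (q ^ j)\<^sup>2"
      by (simp only: c m mult_1_right)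
    finally show ?thesis
      by (simp add: algebra_simps power_mult power_mult_distrib flip: power_mult)
  qed
  then show ?thesis
    by (simp add: aw_basis_def qpochs_def qpoch_def poly_prod flip: prod.distrib)
qed

lemma qpoch_terminating:
  assumes "q \<noteq> 0" "n < k"
  shows "qpoch (q powi (- int n)) q k = 0"
proof -
  have "1 - q powi (- int n) * q ^ n = 0"
    using assms(1) by (simp add: power_int_minus)
  then show ?thesis
    unfolding qpoch_def using assms(2) by (intro prod_zero) auto
qed

lemma basic_hypergeom_terminating:
  assumes "q \<noteq> 0"
  shows "basic_hypergeom (q powi (- int n) # as) bs q z
    = (\<Sum>k\<le>n. qpochs (q powi (- int n) # as) q k / qpochs (bs @ [q]) q k * z ^ k)"
  unfolding basic_hypergeom_def
  by (rule suminf_finite) (auto simp: qpochs_def qpoch_terminating assms)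

lemma poly_askey_wilson_cos:
  assumes "q \<noteq> 0"
  shows "poly (askey_wilson n a b c d q) (of_real (cos \<theta>)) =
    basic_hypergeom
      [q powi (- int n), a * b * c * d * q powi (int n - 1), a * cis \<theta>, a * cis (- \<theta>)]
      [a * b, a * c, a * d] q q"
  unfolding basic_hypergeom_terminating[OF assms] askey_wilson_def poly_sum poly_smult
    poly_aw_basis_cos
  by (rule sum.cong) (simp_all add: qpochs_def)

lemma poly_little_q_jacobi:
  assumes "q \<noteq> 0"
  shows "poly (little_q_jacobi n a b q) x =
    basic_hypergeom [q powi (- int n), a * b * q ^ (n + 1)] [a * q] q (q * x)"
  unfolding basic_hypergeom_terminating[OF assms] little_q_jacobi_def poly_sum poly_smult
  by (rule sum.cong) (simp_all add: qpochs_def poly_power mult.commute)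

lemma complex_poly_eqI_cos:
  fixes p r :: "complex poly"
  assumes "\<And>\<theta>::real. poly p (of_real (cos \<theta>)) = poly r (of_real (cos \<theta>))"
  shows "p = r"
proof (rule ccontr)
  assume "p \<noteq> r"
  then have fin: "finite {x. poly (p - r) x = 0}"
    by (intro poly_roots_finite) simp
  have "complex_of_real ` {-1..1} \<subseteq> {x. poly (p - r) x = 0}"
  proof
    fix x assume "x \<in> complex_of_real ` {-1..1}"
    then obtain t where "x = of_real t" "-1 \<le> t" "t \<le> 1" by auto
    then show "x \<in> {x. poly (p - r) x = 0}"
      using assms[of "arccos t"] by simp
  qed
  then have "finite (complex_of_real ` {-1..1})"
    using fin finite_subset by blast
  then have "finite {-1..1::real}"
    by (rule finite_imageD) (simp add: inj_on_def)
  then show False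
    by (simp add: infinite_Icc)
qed

lemma ex1_linear_monom:
  fixes B :: "nat \<Rightarrow> complex poly"
  shows "\<exists>!T. Vector_Spaces.linear smult smult T \<and> (\<forall>k. T (monom 1 k) = B k)"
proof
  define T where "T p = (\<Sum>k\<le>degree p. smult (coeff p k) (B k))" for p
  have T: "T p = (\<Sum>k\<le>N. smult (coeff p k) (B k))" if "degree p \<le> N" for p N
    unfolding T_def using that
    by (intro sum.mono_neutral_left) (auto simp: coeff_eq_0)
  have "T (p + r) = T p + T r" for p r
  proof -
    let ?N = "max (degree p) (degree r)"
    show ?thesis
      using T[of p ?N] T[of r ?N] T[of "p + r" ?N]
      by (simp add: degree_add_le_max smult_add_left sum.distrib)
  qed
  moreover have "T (smult c p) = smult c (T p)" for c p
    using T[of "smult c p" "degree p"] T[of p "degree p"]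
    by (intro poly_eqI) (simp add: coeff_sum sum_distrib_left mult.assoc degree_smult_le)
  moreover have "T (monom 1 k) = B k" for k
  proof -
    have "T (monom 1 k) = (\<Sum>j\<le>k. if j = k then B j else 0)"
      unfolding T[of "monom 1 k" k, OF degree_monom_le] by (rule sum.cong) auto
    then show ?thesis by simp
  qed
  ultimately show "Vector_Spaces.linear smult smult T \<and> (\<forall>k. T (monom 1 k) = B k)"
    by (auto intro!: Vector_Spaces.linear.intro module_hom.intro module_hom_axioms.intro
        simp: Vector_Spaces.linear_def module_hom_def module_hom_axioms_def
              vector_space_def module_def smult_add_left smult_add_right)
  fix S assume S: "Vector_Spaces.linear smult smult S \<and> (\<forall>k. S (monom 1 k) = B k)"
  then interpret S: Vector_Spaces.linear smult smult S by simp
  show "S = T"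
  proof
    fix p
    have "S p = S (\<Sum>k\<le>degree p. smult (coeff p k) (monom 1 k))"
      by (simp add: smult_monom poly_as_sum_of_monoms)
    also have "\<dots> = T p"
      using S by (simp add: S.sum S.scale T_def)
    finally show "S p = T p" .
  qed
qed

(* The operator T_{a,c,d} exists and is determined by its values on the monomials. *)
lemma ex1_operator:
  "\<exists>!T. Vector_Spaces.linear smult smult T \<and>
     (\<forall>k \<theta>. poly (T (monom 1 k)) (of_real (cos \<theta>)) =
        qpochs [a * cis \<theta>, a * cis (- \<theta>)] q k / (qpoch (a * c) q k * qpoch (a * d) q k))"
proof -
  define B where
    "B k = smult (1 / (qpoch (a * c) q k * qpoch (a * d) q k)) (aw_basis a q k)" for k
  have "(\<forall>\<theta>. poly p (of_real (cos \<theta>)) =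
        qpochs [a * cis \<theta>, a * cis (- \<theta>)] q k / (qpoch (a * c) q k * qpoch (a * d) q k))
      \<longleftrightarrow> p = B k" for p k
    using complex_poly_eqI_cos[of p "B k"] by (auto simp: B_def poly_aw_basis_cos)
  then show ?thesis
    using ex1_linear_monom[of B] by simp
qed

end

theory Submission imports Defs begin

text \<open>
  The two families have the same terminating expansion, up to the factors that \<open>T\<close> supplies. At
  the parameters \<open>ab/q\<close> and \<open>cd/q\<close>, the little \<open>q\<close>-Jacobi numerator parameter
  \<open>(ab/q)(cd/q)q\<^sup>n\<^sup>+\<^sup>1\<close> is \<open>abcd q\<^sup>n\<^sup>-\<^sup>1\<close> and its denominator parameter \<open>(ab/q)q\<close> is \<open>ab\<close>. The
  factors of the \<open>k\<close>-th Askey--Wilson term that are then missing are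
  \<open>(ae\<^sup>i\<^sup>\<theta>, ae\<^sup>-\<^sup>i\<^sup>\<theta>; q)\<^sub>k / (ac, ad; q)\<^sub>k\<close>, and this is \<open>T(x\<^sup>k)\<close>. Linearity of \<open>T\<close> therefore turns one
  expansion into the other, term by term.
\<close>

text \<open>
  The values at \<open>x = cos \<theta>\<close> fill \<open>[-1, 1]\<close>, an infinite set, so they identify \<open>T(x\<^sup>k)\<close> as a
  polynomial; this makes the comparison with the Askey--Wilson expansion one of coefficients.
\<close>

lemma operator_monom_eq_aw_basis:
  fixes p :: "complex poly"
  assumes "\<And>\<theta>::real. poly p (of_real (cos \<theta>)) =
             qpochs [a * cis \<theta>, a * cis (- \<theta>)] q k / (qpoch (a * c) q k * qpoch (a * d) q k)"
  shows "p = smult (1 / (qpoch (a * c) q k * qpoch (a * d) q k)) (aw_basis a q k)"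
  by (rule complex_poly_eqI_cos) (simp add: assms poly_aw_basis_cos)

lemma little_q_jacobi_rescaled:
  assumes "q \<noteq> 0"
  shows "little_q_jacobi n (a * b / q) (c * d / q) q =
    (\<Sum>k\<le>n. smult (qpochs [q powi (- int n), a * b * c * d * q powi (int n - 1)] q k
                   / qpochs [a * b, q] q k * q ^ k) (monom 1 k))"
proof -
  \<comment> \<open>The integer power on the right also covers \<open>n = 0\<close>, where it is \<open>q\<^sup>-\<^sup>1\<close>.\<close>
  have parameter: "a * b / q * (c * d / q) * q ^ (n + 1) = a * b * c * d * q powi (int n - 1)"
    using assms by (simp add: power_int_diff field_simps)
  have scaled_power: "[:0, q:] ^ k = smult (q ^ k) (monom 1 k)" for k
  proof -
    have "[:0, q:] = monom q 1"
      by (simp add: monom_altdef)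
    then show ?thesis
      by (simp add: monom_power smult_monom)
  qed
  show ?thesis
    unfolding little_q_jacobi_def parameter scaled_power
    using assms by (simp add: qpochs_def)
qed

theorem theorem2p4:
  fixes q :: real and a b c d :: complex and n :: nat
    and T :: "complex poly \<Rightarrow> complex poly"
  assumes "0 < q" and "q < 1"
    and "norm a < 1" and "norm b < 1" and "norm c < 1" and "norm d < 1"
    and "Vector_Spaces.linear smult smult T"
    and "\<And>(k::nat) (\<theta>::real). poly (T (monom 1 k)) (of_real (cos \<theta>)) =
           qpochs [a * cis \<theta>, a * cis (- \<theta>)] (of_real q) k
             / (qpoch (a * c) (of_real q) k * qpoch (a * d) (of_real q) k)"
  shows "askey_wilson n a b c d (of_real q) =
           T (little_q_jacobi n (a * b / of_real q) (c * d / of_real q) (of_real q))"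
proof -
  interpret T: Vector_Spaces.linear smult smult T
    by (fact assms)
  have T_monom: "T (monom 1 k) =
      smult (1 / (qpoch (a * c) q k * qpoch (a * d) q k)) (aw_basis a q k)" for k
    by (rule operator_monom_eq_aw_basis) (rule assms)
  have "complex_of_real q \<noteq> 0"
    using assms by simp
  then show ?thesis
    by (simp add: little_q_jacobi_rescaled askey_wilson_def T.sum T.scale T_monom
        qpochs_def mult_ac)
qed

end
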